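(* Let $q$ be a prime power, let $C_m$ be a Hermitian code over $\mathbb{F}_{q^2}$ with $m\ge 2q^2-2q-2$, and let $x^ay^b\in\mathcal{B}\setminus\mathcal{B}_m$ be such that $m+1\le w(x^ay^b)\le m+q+1$. (i) If $D$ is an $\mathbb{F}_{q^2}$-divisor on $\mathcal{H}$ such that $x^ay^b\in\mathcal{N}(\mathrm{In}_\prec(I_D))$ and $D$ is the support of a codeword of $C_m$, then $|D|\ge w(x^ay^b)-(q^2-q)+1$. (ii) There exists an $\mathbb{F}_{q^2}$-divisor $D'$ on $\mathcal{H}$ which is the support of a codeword of $C_m$ and such that $x^ay^b\in\mathcal{N}(\mathrm{In}_\prec(I_{D'}))$ and $|D'|=w(x^ay^b)-(q^2-q)+1$.
   Context: Let $q$ be a prime power. The Hermitian curve $\mathcal{H}$ is the curve in the affine plane over $\mathbb{F}_{q^2}$ defined by $H:=x^{q+1}-y^q-y$. It has exactly $n=q^3$ points $P_1,\dots,P_n$ with coordinates in $\mathbb{F}_{q^2}$; put $E=\{P_1,\dots,P_n\}$. The ideal of $E$ (as a reduced scheme) is $I_E=\langle H,\,x^{q^2}-x,\,y^{q^2}-y\rangle$ and $A_E=\mathbb{F}_{q^2}[x,y]/I_E$. An $\mathbb{F}_{q^2}$-divisor on $\mathcal{H}$ is a reduced zero-dimensional scheme $D$ consisting of pairwise distinct points of $E$ (identified with a subset of $E$); $|D|$ is its number of points and $I_D\subset\mathbb{F}_{q^2}[x,y]$ is its (radical, vanishing) ideal. $\prec$ denotes the term ordering DegRevLex on $\mathbb{F}_{q^2}[x,y]$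 with $y>x$: $x^ry^s\prec x^{r'}y^{s'}$ iff $r+s<r'+s'$, or $r+s=r'+s'$ and $r>r'$. $\mathrm{In}_\prec(I)$ is the initial ideal of $I$ and $\mathcal{N}(\mathrm{In}_\prec(I))$ is the set of monomials not belonging to $\mathrm{In}_\prec(I)$. The $w$-degree of a monomial is $w(x^ry^s)=rq+s(q+1)$. The set $\mathcal{B}=\{x^ry^s : 0\le r\le q,\ 0\le s\le q^2-q-1\}\cup\{y^s : q^2-q\le s\le q^2-1\}$ is a monomial basis of $A_E$. For an integer $m\le q^3+q^2-q-2$ put $\mathcal{B}_m=\{x^ry^s\in\mathcal{B} : rq+s(q+1)\le m\}$. The Hermitian code $C_m\subseteq(\mathbb{F}_{q^2})^n$ is the dual code of the span of the vectors $(f(P_1),\dots,f(P_n))$, $f\in\mathcal{B}_m$. Convention: a code is labelled by the integer $m$ only if $\mathcal{B}$ contains a monomial of $w$-degree $m+1$. The support of a codeword $(c_1,\dots,c_n)$ is identified with the $\mathbb{F}_{q^2}$-divisor $\{P_i : c_i\ne0\}$. *)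

theory Defs
  imports
    "HOL-Library.Cardinality"
    "HOL-Number_Theory.Prime_Powers"
    "HOL-Computational_Algebra.Polynomial"
    "Jordan_Normal_Form.VS_Connect"
begin

text \<open>
  Polynomials in \<open>\<FF>[x, y]\<close> are elements of \<open>\<FF>[x][y]\<close>: the inner variable is \<open>x\<close>, the outer
  one is \<open>y\<close>. A monomial \<open>x^r y^s\<close> is represented by its exponent pair \<open>(r, s)\<close>. The field
  \<open>\<FF>\<close> with \<open>q^2\<close> elements is a finite field type \<^typ>\<open>'a\<close> with \<open>CARD('a) = q^2\<close>.
\<close>

type_synonym expo = "nat \<times> nat"

definition mono_poly :: "expo \<Rightarrow> 'a::comm_semiring_1 poly poly" where
  "mono_poly = (\<lambda>(r, s). monom (monom 1 r) s)"

definition eval2 :: "'a::comm_semiring_1 poly poly \<Rightarrow> 'a \<times> 'a \<Rightarrow> 'a" where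
  "eval2 f = (\<lambda>(x, y). poly (poly f [:y:]) x)"

definition expos :: "'a::zero poly poly \<Rightarrow> expo set" where
  "expos f = {(r, s). coeff (coeff f s) r \<noteq> 0}"

lemma eval2_mono_poly: "eval2 (mono_poly (r, s)) (x, y) = x ^ r * y ^ s"
  by (simp add: eval2_def mono_poly_def poly_monom)


definition drl_less :: "expo \<Rightarrow> expo \<Rightarrow> bool" (infix "\<prec>" 50) where
  "drl_less = (\<lambda>(r, s) (r', s'). r + s < r' + s' \<or> (r + s = r' + s' \<and> r > r'))"

definition is_leading_expo :: "'a::zero poly poly \<Rightarrow> expo \<Rightarrow> bool" where
  "is_leading_expo f e \<longleftrightarrow> e \<in> expos f \<and> (\<forall>e' \<in> expos f - {e}. e' \<prec> e)"

text \<open>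
  The ideal generated by a set is its span in the ring, regarded as a module over itself.
\<close>

definition ideal_gen :: "'a::comm_ring_1 poly poly set \<Rightarrow> 'a poly poly set" where
  "ideal_gen = Modules.module.span (*)"

text \<open>
  The zero polynomial has no leading exponent, so it contributes nothing below.
\<close>

definition initial_ideal :: "'a::comm_ring_1 poly poly set \<Rightarrow> 'a poly poly set" where
  "initial_ideal I = ideal_gen {mono_poly e | e f. f \<in> I \<and> is_leading_expo f e}"

definition standard_monos :: "'a::comm_ring_1 poly poly set \<Rightarrow> expo set" where
  "standard_monos J = {e. mono_poly e \<notin> J}"

definition vanishing_ideal :: "('a::comm_semiring_1 \<times> 'a) set \<Rightarrow> 'a poly poly set" where
  "vanishing_ideal D = {f. \<forall>P \<in> D. eval2 f P = 0}"


definition hermitian_poly :: "nat \<Rightarrow> 'a::comm_ring_1 poly poly" where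
  "hermitian_poly q = mono_poly (q + 1, 0) - mono_poly (0, q) - mono_poly (0, 1)"

definition hermitian_points :: "nat \<Rightarrow> ('a::comm_ring_1 \<times> 'a) set" where
  "hermitian_points q = {P. eval2 (hermitian_poly q) P = 0}"

definition hermitian_divisor :: "nat \<Rightarrow> ('a::comm_ring_1 \<times> 'a) set \<Rightarrow> bool" where
  "hermitian_divisor q D \<longleftrightarrow> D \<subseteq> hermitian_points q"


definition wdeg :: "nat \<Rightarrow> expo \<Rightarrow> nat" where
  "wdeg q = (\<lambda>(r, s). r * q + s * (q + 1))"

text \<open>
  For \<open>q \<ge> 2\<close> none of the subtractions on natural numbers is truncated.
\<close>

definition B_monos :: "nat \<Rightarrow> expo set" where
  "B_monos q = {(r, s). r \<le> q \<and> s \<le> q^2 - q - 1} \<union> {(0, s) | s. q^2 - q \<le> s \<and> s \<le> q^2 - 1}"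

definition B_upto :: "nat \<Rightarrow> int \<Rightarrow> expo set" where
  "B_upto q m = {e \<in> B_monos q. int (wdeg q e) \<le> m}"


text \<open>
  The curve has \<open>q^3\<close> points over \<open>\<FF>\<close>. Its points are enumerated by a function \<open>P\<close> on
  \<open>{..<q^3}\<close>, and vectors are indexed from 0 accordingly.
\<close>

definition eval_vec :: "nat \<Rightarrow> (nat \<Rightarrow> 'a::comm_semiring_1 \<times> 'a) \<Rightarrow> 'a poly poly \<Rightarrow> 'a vec" where
  "eval_vec n P f = vec n (\<lambda>i. eval2 f (P i))"

definition vec_span :: "nat \<Rightarrow> 'a::field vec set \<Rightarrow> 'a vec set" where
  "vec_span n = LinearCombinations.module.span class_ring (module_vec TYPE('a) n)"

definition dual_code :: "nat \<Rightarrow> 'a::comm_ring_1 vec set \<Rightarrow> 'a vec set" where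
  "dual_code n S = {c \<in> carrier_vec n. \<forall>v \<in> S. c \<bullet> v = 0}"

definition hermitian_code :: "nat \<Rightarrow> (nat \<Rightarrow> 'a::field \<times> 'a) \<Rightarrow> int \<Rightarrow> 'a vec set" where
  "hermitian_code q P m =
     dual_code (q^3) (vec_span (q^3) ((\<lambda>e. eval_vec (q^3) P (mono_poly e)) ` B_upto q m))"

definition codeword_support :: "(nat \<Rightarrow> 'a::zero \<times> 'a) \<Rightarrow> 'a vec \<Rightarrow> ('a \<times> 'a) set" where
  "codeword_support P c = P ` {i. i < dim_vec c \<and> c $ i \<noteq> 0}"

end

theory Submission
  imports Defs
begin

text \<open>
  On the Hermitian curve the graded ordering and the ordering by \<open>w\<close>-degree agree on the
  monomials with \<open>x\<close>-exponent at most \<open>q\<close>, to which all others can be reduced by the equation of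
  the curve. The \<open>w\<close>-degree is the pole order at infinity, and the pole orders form the semigroup
  generated by \<open>q\<close> and \<open>q + 1\<close>, which has at most \<open>q(q - 1)/2\<close> gaps. Write \<open>w\<close> for the
  \<open>w\<close>-degree of \<open>x^a y^b\<close>.

  Lower bound. If \<open>x^a y^b\<close> is a standard monomial for \<open>D\<close>, then on \<open>D\<close> it is not a combination of
  functions of smaller pole order. A Feng--Rao argument turns this into the bound: the monomials
  whose pole orders \<open>n\<close> are such that both \<open>n\<close> and \<open>w - n\<close> are nongaps are linearly independent
  on \<open>D\<close>, and there are at least \<open>w + 1 - q(q - 1)\<close> of them. This is
  \<open>card_ge_if_standard\<close>.

  Existence. Summation over all points of the curve kills every monomial of \<open>w\<close>-degree below
  \<open>(q^2 - 1)(q + 1)\<close> and equals \<open>-1\<close> at that degree (\<open>power_sum_curve\<close>); in geometric terms this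
  is the residue theorem for \<open>dx / (x^(q^2) - x)\<close>. Weighting the sum with a function \<open>g\<close> of pole order
  \<open>t = (q^2 - 1)(q + 1) - w\<close> moves the critical degree down to \<open>w\<close>, which is larger than \<open>m\<close>. The
  values of \<open>g\<close> are then a codeword whose support has \<open>x^a y^b\<close> as a standard monomial, and the
  support has the size sought exactly when \<open>g\<close> has \<open>t\<close> distinct rational zeros. Such a \<open>g\<close> is
  found as a product of vertical and horizontal lines (\<open>exists_minimal_functional\<close>).
\<close>

section \<open>Exponents and leading monomials\<close>

lemma finite_expos: "finite (expos p)"
proof (rule finite_subset)
  show "expos p \<subseteq> (\<lambda>(s, r). (r, s)) ` (SIGMA s:{..degree p}. {..degree (coeff p s)})"
    by (force simp: expos_def image_iff intro: le_degree)
qed simp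

lemma eval2_eq_sum_expos:
  fixes p :: "'a::comm_ring_1 poly poly"
  shows "eval2 p (x, y) = (\<Sum>(r, s)\<in>expos p. coeff (coeff p s) r * (x ^ r * y ^ s))"
proof -
  have "eval2 p (x, y)
      = (\<Sum>s\<le>degree p. \<Sum>r\<le>degree (coeff p s). coeff (coeff p s) r * (x ^ r * y ^ s))"
    by (simp add: eval2_def poly_altdef[of p] poly_sum)
       (simp add: poly_altdef sum_distrib_right mult.assoc)
  also have "\<dots> = (\<Sum>(s, r)\<in>(SIGMA s:{..degree p}. {..degree (coeff p s)}).
      coeff (coeff p s) r * (x ^ r * y ^ s))"
    by (subst sum.Sigma) auto
  also have "\<dots> = (\<Sum>(s, r)\<in>{(s, r). (r, s) \<in> expos p}. coeff (coeff p s) r * (x ^ r * y ^ s))"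
  proof (intro sum.mono_neutral_right ballI)
    show "{(s, r). (r, s) \<in> expos p} \<subseteq> (SIGMA s:{..degree p}. {..degree (coeff p s)})"
      by (force simp: expos_def intro: le_degree)
  qed (auto simp: expos_def)
  also have "\<dots> = (\<Sum>(r, s)\<in>expos p. coeff (coeff p s) r * (x ^ r * y ^ s))"
    by (rule sum.reindex_bij_witness[where i = "\<lambda>(s, r). (r, s)" and j = "\<lambda>(s, r). (r, s)"]) auto
  finally show ?thesis .
qed

lemma coeff_mono_poly_mult:
  fixes p :: "'a::comm_ring_1 poly poly"
  shows "coeff (coeff (mono_poly (i, j) * p) s) r
    = (if j \<le> s \<and> i \<le> r then coeff (coeff p (s - j)) (r - i) else 0)"
  by (simp add: mono_poly_def coeff_monom_mult)

lemma expos_mono_poly: "expos (mono_poly e :: 'a::comm_ring_1 poly poly) = {e}"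
  by (cases e) (auto simp: expos_def mono_poly_def split: if_splits)

lemma expos_mono_poly_mult:
  fixes p :: "'a::comm_ring_1 poly poly"
  shows "expos (mono_poly (i, j) * p) = (\<lambda>(r, s). (r + i, s + j)) ` expos p"
proof (rule Set.set_eqI)
  fix e :: expo
  obtain r s where e: "e = (r, s)" by force
  show "e \<in> expos (mono_poly (i, j) * p) \<longleftrightarrow> e \<in> (\<lambda>(r, s). (r + i, s + j)) ` expos p"
  proof
    assume "e \<in> expos (mono_poly (i, j) * p)"
    then have "j \<le> s" "i \<le> r" "(r - i, s - j) \<in> expos p"
      by (auto simp: e expos_def coeff_mono_poly_mult split: if_splits)
    then show "e \<in> (\<lambda>(r, s). (r + i, s + j)) ` expos p"
      by (auto simp: e image_iff intro!: bexI[of _ "(r - i, s - j)"])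
  qed (auto simp: expos_def coeff_mono_poly_mult)
qed

lemma leading_expo_shift:
  fixes f :: "'a::comm_ring_1 poly poly"
  assumes "is_leading_expo f (r, s)"
  shows "is_leading_expo (mono_poly (i, j) * f) (r + i, s + j)"
  using assms unfolding is_leading_expo_def expos_mono_poly_mult
  by (force simp: drl_less_def)

lemma module_mult: "Modules.module ((*) :: 'a::comm_ring_1 \<Rightarrow> 'a \<Rightarrow> 'a)"
  by unfold_locales (simp_all add: algebra_simps)

text \<open>
  In a monomial ideal, every monomial that occurs in a member is divisible by a generator:
  this property is inherited by sums, and multiples of a generator have it by construction.
\<close>

lemma mono_poly_in_ideal_gen_dest:
  assumes "mono_poly e \<in> ideal_gen (mono_poly ` E :: 'a::comm_ring_1 poly poly set)"
  shows "\<exists>e'\<in>E. fst e' \<le> fst e \<and> snd e' \<le> snd e"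
proof -
  interpret Modules.module "(*) :: 'a poly poly \<Rightarrow> _" by (rule module_mult)
  let ?U = "{e. \<exists>e'\<in>E. fst e' \<le> fst e \<and> snd e' \<le> snd e}"
  have "expos p \<subseteq> ?U" if "p \<in> span (mono_poly ` E)" for p :: "'a poly poly"
    using that
  proof (induction rule: span_induct_alt)
    case base
    then show ?case by (simp add: expos_def)
  next
    case (step c x y)
    then obtain i j where ij: "(i, j) \<in> E" "x = mono_poly (i, j)" by auto
    have "expos (c * x + y) \<subseteq> expos (mono_poly (i, j) * c) \<union> expos y"
      by (auto simp: expos_def ij mult.commute)
    moreover have "expos (mono_poly (i, j) * c) \<subseteq> ?U"
      unfolding expos_mono_poly_mult using ij(1) by force
    ultimately show ?case using step.IH by blast
  qed
  then have "expos (mono_poly e :: 'a poly poly) \<subseteq> ?U"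
    using assms by (simp add: ideal_gen_def)
  then show ?thesis by (simp add: expos_mono_poly)
qed

lemma eval2_mult: "eval2 (f * g) P = eval2 f P * eval2 (g :: 'a::comm_ring_1 poly poly) P"
  by (cases P) (simp add: eval2_def)

lemma eval2_diff: "eval2 (f - g) P = eval2 f P - eval2 (g :: 'a::comm_ring_1 poly poly) P"
  by (cases P) (simp add: eval2_def)

lemma eval2_add: "eval2 (f + g) P = eval2 f P + eval2 (g :: 'a::comm_ring_1 poly poly) P"
  by (cases P) (simp add: eval2_def)

text \<open>
  A monomial divisible by a leading monomial of the ideal is itself one, because the ordering
  is compatible with multiplication. So the initial ideal contains no monomials beyond the
  leading monomials themselves.
\<close>

lemma standard_mono_iff_not_leading:
  fixes D :: "('a::comm_ring_1 \<times> 'a) set"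
  shows "e \<in> standard_monos (initial_ideal (vanishing_ideal D))
    \<longleftrightarrow> \<not> (\<exists>f\<in>vanishing_ideal D. is_leading_expo f e)"
proof -
  interpret Modules.module "(*) :: 'a poly poly \<Rightarrow> _" by (rule module_mult)
  let ?E = "{e. \<exists>f\<in>vanishing_ideal D. is_leading_expo f e}"
  have ideal: "initial_ideal (vanishing_ideal D) = ideal_gen (mono_poly ` ?E)"
    unfolding initial_ideal_def by (rule arg_cong[where f = ideal_gen]) blast
  have "mono_poly e \<in> ideal_gen (mono_poly ` ?E) \<longleftrightarrow> e \<in> ?E"
  proof
    assume e: "e \<in> ?E"
    show "mono_poly e \<in> ideal_gen (mono_poly ` ?E)"
      unfolding ideal_gen_def by (rule Modules.module.span_base[OF module_mult imageI[OF e]])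
  next
    assume "mono_poly e \<in> ideal_gen (mono_poly ` ?E)"
    then obtain f i j where f: "f \<in> vanishing_ideal D" "is_leading_expo f (i, j)"
      and le: "i \<le> fst e" "j \<le> snd e"
      using mono_poly_in_ideal_gen_dest[of e ?E] by fastforce
    have "is_leading_expo (mono_poly (fst e - i, snd e - j) * f) e"
      using leading_expo_shift[OF f(2), of "fst e - i" "snd e - j"] le by simp
    moreover have "mono_poly (fst e - i, snd e - j) * f \<in> vanishing_ideal D"
      using f(1) by (simp add: vanishing_ideal_def eval2_mult)
    ultimately show "e \<in> ?E" by blast
  qed
  then show ?thesis unfolding standard_monos_def ideal by blast
qed

text \<open>
  If \<open>x^a y^b\<close> led a polynomial vanishing on \<open>D\<close>, the functional would send that polynomial
  both to \<open>0\<close> and to its leading coefficient times the value on \<open>x^a y^b\<close>.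
\<close>

lemma standard_mono_if_functional:
  fixes g :: "'a::field \<times> 'a \<Rightarrow> 'a"
  assumes low: "\<And>r s. (r, s) \<prec> (a, b) \<Longrightarrow> (\<Sum>(x, y)\<in>D. g (x, y) * (x ^ r * y ^ s)) = 0"
    and top: "(\<Sum>(x, y)\<in>D. g (x, y) * (x ^ a * y ^ b)) \<noteq> 0"
  shows "(a, b) \<in> standard_monos (initial_ideal (vanishing_ideal D))"
  unfolding standard_mono_iff_not_leading
proof
  let ?m = "\<lambda>r s. \<Sum>(x, y)\<in>D. g (x, y) * (x ^ r * y ^ s)"
  assume "\<exists>f\<in>vanishing_ideal D. is_leading_expo f (a, b)"
  then obtain f where f: "f \<in> vanishing_ideal D" "(a, b) \<in> expos f"
    and less: "\<And>e. e \<in> expos f \<Longrightarrow> e \<noteq> (a, b) \<Longrightarrow> e \<prec> (a, b)"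
    by (auto simp: is_leading_expo_def)
  have "0 = (\<Sum>(x, y)\<in>D. g (x, y) * eval2 f (x, y))"
    using f(1) by (intro sum.neutral[symmetric]) (auto simp: vanishing_ideal_def)
  also have "\<dots> = (\<Sum>(x, y)\<in>D. \<Sum>(r, s)\<in>expos f. coeff (coeff f s) r * (g (x, y) * (x ^ r * y ^ s)))"
    unfolding eval2_eq_sum_expos sum_distrib_left
    by (intro sum.cong) (auto simp: algebra_simps intro!: sum.cong)
  also have "\<dots> = (\<Sum>(r, s)\<in>expos f. coeff (coeff f s) r * ?m r s)"
    unfolding case_prod_unfold by (subst sum.swap) (simp add: sum_distrib_left)
  also have "\<dots> = (\<Sum>(r, s)\<in>{(a, b)}. coeff (coeff f s) r * ?m r s)"
  proof (intro sum.mono_neutral_right finite_expos ballI)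
    fix e assume "e \<in> expos f - {(a, b)}"
    then show "(case e of (r, s) \<Rightarrow> coeff (coeff f s) r * ?m r s) = 0"
      using less[of e] low by (cases e) auto
  qed (use f in simp)
  finally show False using f(2) top by (simp add: expos_def)
qed

section \<open>Functions spanned by smaller monomials\<close>

text \<open>
  The \<open>w\<close>-degree of \<open>x^r y^s\<close> is \<open>(r + s)(q + 1) - r\<close>. A drop of the total degree by one costs
  \<open>q + 1\<close>, which exceeds the term \<open>a \<le> q\<close>; at equal total degree the larger power of \<open>x\<close>
  is the smaller monomial in both orders. For \<open>r, a \<le> q\<close> the two orders thus coincide.
\<close>

lemma wdeg_less_if_drl_less:
  assumes "a \<le> q" "(r, s) \<prec> (a, b)"
  shows "wdeg q (r, s) < wdeg q (a, b)"
proof -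
  have w: "wdeg q (i, j) + i = (i + j) * (q + 1)" for i j
    by (simp add: wdeg_def algebra_simps)
  show ?thesis
  proof (cases "r + s < a + b")
    case True
    then have "(r + s + 1) * (q + 1) \<le> (a + b) * (q + 1)" by (intro mult_le_mono1) simp
    then have "(r + s) * (q + 1) + (q + 1) \<le> (a + b) * (q + 1)" by (simp add: algebra_simps)
    then show ?thesis using w[of r s] w[of a b] assms(1) by linarith
  next
    case False
    then have "r + s = a + b" "a < r" using assms(2) by (auto simp: drl_less_def)
    then show ?thesis using w[of r s] w[of a b] by simp
  qed
qed

lemma drl_less_total: "e \<noteq> e' \<Longrightarrow> e \<prec> e' \<or> e' \<prec> e"
  by (cases e; cases e') (auto simp: drl_less_def)

text \<open>
  Values outside \<open>D\<close> are left unconstrained, so that this space plays the part of a subspace of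
  the coordinate ring of \<open>D\<close> without a quotient being formed.
\<close>

definition lower_functions :: "('a::comm_ring_1 \<times> 'a) set \<Rightarrow> expo \<Rightarrow> ('a \<times> 'a \<Rightarrow> 'a) set" where
  "lower_functions D e = {f. \<exists>p. (\<forall>e'\<in>expos p. e' \<prec> e) \<and> (\<forall>P\<in>D. f P = eval2 p P)}"

lemma lower_functions_zero: "(\<And>P. P \<in> D \<Longrightarrow> f P = 0) \<Longrightarrow> f \<in> lower_functions D e"
  unfolding lower_functions_def
  by (auto intro!: exI[of _ 0] simp: expos_def eval2_def case_prod_unfold)

lemma lower_functions_cong:
  assumes "f \<in> lower_functions D e" "\<And>P. P \<in> D \<Longrightarrow> f P = f' P"
  shows "f' \<in> lower_functions D e"
  using assms unfolding lower_functions_def by force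

lemma lower_functions_add:
  assumes "f \<in> lower_functions D e" "f' \<in> lower_functions D e"
  shows "(\<lambda>P. f P + f' P) \<in> lower_functions D e"
proof -
  from assms obtain p p' where
    "\<forall>e'\<in>expos p. e' \<prec> e" "\<forall>P\<in>D. f P = eval2 p P"
    "\<forall>e'\<in>expos p'. e' \<prec> e" "\<forall>P\<in>D. f' P = eval2 p' P"
    unfolding lower_functions_def by blast
  moreover have "expos (p + p') \<subseteq> expos p \<union> expos p'"
    by (auto simp: expos_def)
  ultimately show ?thesis
    unfolding lower_functions_def by (auto intro!: exI[of _ "p + p'"] simp: eval2_add)
qed

lemma lower_functions_scale:
  assumes "f \<in> lower_functions D e"
  shows "(\<lambda>P. c * f P) \<in> lower_functions D e"
proof -
  from assms obtain p where "\<forall>e'\<in>expos p. e' \<prec> e" "\<forall>P\<in>D. f P = eval2 p P"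
    unfolding lower_functions_def by blast
  moreover have "expos ([:[:c:]:] * p) \<subseteq> expos p"
    by (auto simp: expos_def)
  moreover have "eval2 ([:[:c:]:] * p) P = c * eval2 p P" for P
    by (cases P) (simp add: eval2_def)
  ultimately show ?thesis
    unfolding lower_functions_def by (intro CollectI exI[of _ "[:[:c:]:] * p"]) auto
qed

lemma lower_functions_sum:
  assumes "\<And>i. i \<in> I \<Longrightarrow> f i \<in> lower_functions D e"
  shows "(\<lambda>P. \<Sum>i\<in>I. f i P) \<in> lower_functions D e"
  using assms
proof (induction I rule: infinite_finite_induct)
  case (insert i I)
  then show ?case using lower_functions_add[of "f i"] by simp
qed (simp_all add: lower_functions_zero)

definition mono_fun :: "expo \<Rightarrow> 'a::comm_ring_1 \<times> 'a \<Rightarrow> 'a" where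
  "mono_fun = (\<lambda>(r, s) (x, y). x ^ r * y ^ s)"

lemma mono_fun_eq_eval2: "mono_fun e = eval2 (mono_poly e)"
  by (cases e) (auto simp: mono_fun_def eval2_mono_poly)

lemma mono_fun_mult: "mono_fun (r, s) P * mono_fun (r', s') P = mono_fun (r + r', s + s') P"
  by (simp add: mono_fun_def case_prod_unfold power_add ac_simps)

lemma mono_fun_not_lower:
  fixes D :: "('a::comm_ring_1 \<times> 'a) set"
  assumes "e \<in> standard_monos (initial_ideal (vanishing_ideal D))"
  shows "mono_fun e \<notin> lower_functions D e"
proof
  assume "mono_fun e \<in> lower_functions D e"
  then obtain p where p: "\<forall>e'\<in>expos p. e' \<prec> e" "\<forall>P\<in>D. mono_fun e P = eval2 p P"
    unfolding lower_functions_def by blast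
  have "\<not> e \<prec> e" by (simp add: drl_less_def case_prod_unfold)
  then have e: "e \<notin> expos p" using p(1) by blast
  have "expos (mono_poly e - p) \<subseteq> {e} \<union> expos p"
    unfolding expos_mono_poly[of e, where 'a = 'a, symmetric] by (auto simp: expos_def)
  moreover have "e \<in> expos (mono_poly e - p)"
    using e expos_mono_poly[of e, where 'a = 'a] by (cases e) (auto simp: expos_def mono_poly_def)
  ultimately have "is_leading_expo (mono_poly e - p) e"
    using p(1) unfolding is_leading_expo_def by blast
  moreover have "mono_poly e - p \<in> vanishing_ideal D"
    using p(2) by (simp add: vanishing_ideal_def eval2_diff mono_fun_eq_eval2)
  ultimately show False using assms unfolding standard_mono_iff_not_leading by blast
qed

lemma mem_hermitian_points:
  "(x, y) \<in> hermitian_points q \<longleftrightarrow> x ^ (q + 1) = y ^ q + (y :: 'a::comm_ring_1)"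
  by (simp add: hermitian_points_def hermitian_poly_def eval2_def mono_poly_def poly_monom
      algebra_simps eq_diff_eq)

text \<open>
  The equation of the curve lowers the power of \<open>x\<close> by \<open>q + 1\<close>. The first resulting monomial has
  the same \<open>w\<close>-degree, the second a smaller one. Hence modulo lower \<open>w\<close>-degree only the
  \<open>w\<close>-degree of a monomial matters, which the next lemmas make precise.
\<close>

lemma curve_reduction:
  fixes D :: "('a::comm_ring_1 \<times> 'a) set"
  assumes "D \<subseteq> hermitian_points q" "P \<in> D"
  shows "mono_fun (r + (q + 1), s) P = mono_fun (r, s + q) P + mono_fun (r, s + 1) P"
proof -
  obtain x y where P: "P = (x, y)" by force
  then have "x ^ (q + 1) = y ^ q + y" using assms mem_hermitian_points by blast
  then show ?thesis
    unfolding P mono_fun_def by (simp only: power_add split) (simp add: algebra_simps)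
qed

lemma wdeg_eq_imp_eq:
  assumes "wdeg q (r, s) = wdeg q (a, b)" "r \<le> q" "a \<le> q"
  shows "(r, s) = (a, b)"
  using assms drl_less_total wdeg_less_if_drl_less by (metis less_irrefl)

lemma low_wdeg_in_lower_functions:
  fixes D :: "('a::comm_ring_1 \<times> 'a) set"
  assumes D: "D \<subseteq> hermitian_points q" and a: "a \<le> q" and q: "2 \<le> q"
  shows "wdeg q (r, s) < wdeg q (a, b) \<Longrightarrow> mono_fun (r, s) \<in> lower_functions D (a, b)"
proof (induction r arbitrary: s rule: less_induct)
  case (less r)
  show ?case
  proof (cases "r \<le> q")
    case True
    then have "(r, s) \<prec> (a, b)"
      using less.prems drl_less_total[of "(r, s)" "(a, b)"] wdeg_less_if_drl_less[of r q a b s]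
      by fastforce
    then show ?thesis
      unfolding lower_functions_def mono_fun_eq_eval2
      by (intro CollectI exI[of _ "mono_poly (r, s)"]) (simp add: expos_mono_poly)
  next
    case False
    then obtain r' where r: "r = r' + (q + 1)"
      by (metis add.commute le_add_diff_inverse not_less_eq_eq Suc_eq_plus1)
    have "wdeg q (r', s + q) = wdeg q (r, s)" "wdeg q (r', s + 1) \<le> wdeg q (r, s)"
      using q by (simp_all add: r wdeg_def algebra_simps)
    then have "(\<lambda>P. mono_fun (r', s + q) P + mono_fun (r', s + 1) P) \<in> lower_functions D (a, b)"
      using less.prems r by (intro lower_functions_add less.IH) auto
    then show ?thesis
      by (rule lower_functions_cong) (simp only: r curve_reduction[OF D])
  qed
qed

lemma equal_wdeg_congruent_lower_functions:
  fixes D :: "('a::comm_ring_1 \<times> 'a) set"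
  assumes D: "D \<subseteq> hermitian_points q" and a: "a \<le> q" and q: "2 \<le> q"
  shows "wdeg q (r, s) = wdeg q (a, b) \<Longrightarrow>
    (\<lambda>P. mono_fun (r, s) P - mono_fun (a, b) P) \<in> lower_functions D (a, b)"
proof (induction r arbitrary: s rule: less_induct)
  case (less r)
  show ?case
  proof (cases "r \<le> q")
    case True
    then show ?thesis
      using wdeg_eq_imp_eq[OF less.prems True a] by (intro lower_functions_zero) simp
  next
    case False
    then obtain r' where r: "r = r' + (q + 1)"
      by (metis add.commute le_add_diff_inverse not_less_eq_eq Suc_eq_plus1)
    have "wdeg q (r', s + q) = wdeg q (a, b)" "wdeg q (r', s + 1) < wdeg q (a, b)"
      using q mult_le_mono[OF q q] less.prems[unfolded r] by (simp_all add: wdeg_def algebra_simps)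
    then have "(\<lambda>P. (mono_fun (r', s + q) P - mono_fun (a, b) P) + mono_fun (r', s + 1) P)
        \<in> lower_functions D (a, b)"
      using r by (intro lower_functions_add less.IH low_wdeg_in_lower_functions[OF D a q]) auto
    then show ?thesis
      by (rule lower_functions_cong) (simp only: r curve_reduction[OF D] diff_add_eq)
  qed
qed

section \<open>Gaps of the Weierstrass semigroup\<close>

text \<open>
  The numbers outside the semigroup generated by \<open>q\<close> and \<open>q + 1\<close>: writing
  \<open>n = rq + s(q + 1)\<close> with \<open>s < q\<close> forces \<open>s = n mod q\<close> and \<open>r = n div q - s\<close>.
\<close>

definition gaps :: "nat \<Rightarrow> nat set" where
  "gaps q = {n. n div q < n mod q}"

lemma nongap_eq_wdeg:
  assumes "n \<notin> gaps q"
  obtains e where "wdeg q e = n"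
proof -
  have le: "n mod q \<le> n div q" using assms by (simp add: gaps_def)
  then have "(n div q - n mod q) * q + n mod q * (q + 1) = (n div q - n mod q + n mod q) * q + n mod q"
    by (simp add: algebra_simps)
  also have "\<dots> = n" using le by simp
  finally show ?thesis using that[of "(n div q - n mod q, n mod q)"] by (simp add: wdeg_def)
qed

lemma gaps_card:
  assumes "2 \<le> q"
  shows "finite (gaps q)" "2 * card (gaps q) \<le> q * (q - 1)"
proof -
  let ?S = "SIGMA v:{..<q}. {..<v}"
  have sub: "gaps q \<subseteq> (\<lambda>(v, k). k * q + v) ` ?S"
  proof
    fix n assume "n \<in> gaps q"
    then have "(n mod q, n div q) \<in> ?S" using assms by (simp add: gaps_def)
    moreover have "n = (\<lambda>(v, k). k * q + v) (n mod q, n div q)" by simp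
    ultimately show "n \<in> (\<lambda>(v, k). k * q + v) ` ?S" by (rule rev_image_eqI)
  qed
  have fin: "finite ?S" by simp
  show "finite (gaps q)" using finite_subset[OF sub] fin by blast
  have "card (gaps q) \<le> card ?S"
    using sub fin by (rule surj_card_le[rotated])
  also have "\<dots> = \<Sum>{..<q}" by simp
  also have "\<dots> = q * (q - 1) div 2" by (simp add: lessThan_atLeast0 Sum_Ico_nat)
  finally show "2 * card (gaps q) \<le> q * (q - 1)" by linarith
qed

section \<open>The lower bound\<close>

text \<open>
  Over a finite field linear independence can be exploited by counting: taking linear
  combinations embeds the coefficient vectors indexed by \<open>T\<close> into the functions on \<open>D\<close>.
\<close>

lemma card_le_if_independent_on:
  fixes h :: "'t \<Rightarrow> 'p \<Rightarrow> 'a::{field, finite}"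
  assumes fin: "finite T" "finite D"
    and indep: "\<And>l t. (\<And>P. P \<in> D \<Longrightarrow> (\<Sum>t\<in>T. l t * h t P) = 0) \<Longrightarrow> t \<in> T \<Longrightarrow> l t = 0"
  shows "card T \<le> card D"
proof -
  let ?ev = "\<lambda>l. restrict (\<lambda>P. \<Sum>t\<in>T. l t * h t P) D"
  have "inj_on ?ev (T \<rightarrow>\<^sub>E UNIV)"
  proof (rule inj_onI)
    fix l l' assume l: "l \<in> T \<rightarrow>\<^sub>E UNIV" "l' \<in> T \<rightarrow>\<^sub>E UNIV" and eq: "?ev l = ?ev l'"
    have "(\<Sum>t\<in>T. (l t - l' t) * h t P) = 0" if "P \<in> D" for P
      using fun_cong[OF eq, of P] that by (simp add: sum_subtractf left_diff_distrib)
    then have "l t - l' t = 0" if "t \<in> T" for t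
      using indep[of "\<lambda>t. l t - l' t" t] that by blast
    then show "l = l'" using l by (intro PiE_ext[of l T "\<lambda>_. UNIV" l']) auto
  qed
  moreover have "?ev ` (T \<rightarrow>\<^sub>E UNIV) \<subseteq> D \<rightarrow>\<^sub>E UNIV" by auto
  ultimately have "card (T \<rightarrow>\<^sub>E (UNIV :: 'a set)) \<le> card (D \<rightarrow>\<^sub>E (UNIV :: 'a set))"
    by (rule card_inj_on_le) (use fin in \<open>auto intro: finite_PiE\<close>)
  then have "CARD('a) ^ card T \<le> CARD('a) ^ card D"
    using fin by (simp add: card_PiE)
  moreover have "1 < CARD('a)"
    using card_mono[of "UNIV :: 'a set" "{0, 1}"] by simp
  ultimately show ?thesis by (simp only: power_increasing_iff)
qed

text \<open>
  Put \<open>w = wdeg q (a, b)\<close> and take one monomial of each \<open>w\<close>-degree \<open>n\<close> for which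
  both \<open>n\<close> and \<open>w - n\<close> are nongaps. These monomials are independent on \<open>D\<close>: multiply a
  dependency whose top degree is \<open>k\<close> by the monomial of degree \<open>w - k\<close>. The
  top term becomes \<open>x^a y^b\<close> modulo smaller monomials and all other terms fall below it, so
  \<open>x^a y^b\<close> would be a combination of smaller monomials on \<open>D\<close>. At most twice the number of
  gaps is lost among the \<open>w + 1\<close> candidates \<open>n\<close>.
\<close>

lemma card_ge_if_standard:
  fixes D :: "('a::{field, finite} \<times> 'a) set"
  assumes D: "D \<subseteq> hermitian_points q" and a: "a \<le> q" and q: "2 \<le> q"
    and std: "(a, b) \<in> standard_monos (initial_ideal (vanishing_ideal D))"
  shows "wdeg q (a, b) + 1 \<le> card D + q * (q - 1)"
proof -
  define w where "w = wdeg q (a, b)"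
  define T where "T = {n \<in> {..w}. n \<notin> gaps q \<and> w - n \<notin> gaps q}"
  let ?V = "lower_functions D (a, b)"
  have "\<forall>n. \<exists>e. n \<notin> gaps q \<longrightarrow> wdeg q e = n" using nongap_eq_wdeg by blast
  then obtain e where e: "\<And>n. n \<notin> gaps q \<Longrightarrow> wdeg q (e n) = n"
    using choice[of "\<lambda>n e. n \<notin> gaps q \<longrightarrow> wdeg q e = n"] by blast
  have "card T \<le> card D"
  proof (rule card_le_if_independent_on[where h = "\<lambda>n. mono_fun (e n)"])
    fix l :: "nat \<Rightarrow> 'a" and t
    assume zero: "\<And>P. P \<in> D \<Longrightarrow> (\<Sum>n\<in>T. l n * mono_fun (e n) P) = 0" and t: "t \<in> T"
    show "l t = 0"
    proof (rule ccontr)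
      assume "l t \<noteq> 0"
      define k where "k = Max {n \<in> T. l n \<noteq> 0}"
      have finT: "finite T" by (simp add: T_def)
      have k: "k \<in> T" "l k \<noteq> 0" and max: "\<And>n. n \<in> T \<Longrightarrow> l n \<noteq> 0 \<Longrightarrow> n \<le> k"
        using Max_in[of "{n \<in> T. l n \<noteq> 0}"] finT t \<open>l t \<noteq> 0\<close>
        unfolding k_def by (auto intro!: Max_ge)
      define e' where "e' = e (w - k)"
      have wk: "wdeg q e' = w - k" "k \<le> w" using k e by (auto simp: T_def e'_def)
      \<comment> \<open>Subtracting \<open>x^a y^b\<close> from the product of top degree makes every \<open>F n\<close> with \<open>l n \<noteq> 0\<close> lower.\<close>
      define F where
        "F n P = mono_fun (e n) P * mono_fun e' P - (if n = k then mono_fun (a, b) P else 0)"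
        for n and P :: "'a \<times> 'a"
      have F: "(\<lambda>P. l n * F n P) \<in> ?V" if n: "n \<in> T" for n
      proof (cases "l n = 0")
        case True
        then show ?thesis by (simp add: lower_functions_zero)
      next
        case False
        then have nk: "n \<le> k" using n max by blast
        define rs where "rs = (fst (e n) + fst e', snd (e n) + snd e')"
        have w_rs: "wdeg q rs = n + (w - k)"
          using wk e[of n] n by (simp add: T_def rs_def wdeg_def case_prod_unfold algebra_simps)
        have prod: "mono_fun (e n) P * mono_fun e' P = mono_fun rs P" for P :: "'a \<times> 'a"
          unfolding rs_def by (simp flip: mono_fun_mult)
        have "F n \<in> ?V"
        proof (cases "n = k")
          case True
          then show ?thesis
            unfolding F_def prod
            using equal_wdeg_congruent_lower_functions[OF D a q, of "fst rs" "snd rs" b] w_rs wk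
            by (simp add: w_def)
        next
          case False
          then show ?thesis
            unfolding F_def prod
            using low_wdeg_in_lower_functions[OF D a q, of "fst rs" "snd rs" b] w_rs wk nk
            by (simp add: w_def)
        qed
        then show ?thesis by (rule lower_functions_scale)
      qed
      have "(\<lambda>P. - inverse (l k) * (\<Sum>n\<in>T. l n * F n P)) \<in> ?V"
        by (intro lower_functions_scale lower_functions_sum F)
      then have "mono_fun (a, b) \<in> ?V"
      proof (rule lower_functions_cong)
        fix P assume P: "P \<in> D"
        have "(\<Sum>n\<in>T. l n * F n P) = (\<Sum>n\<in>T. l n * mono_fun (e n) P) * mono_fun e' P
            - (\<Sum>n\<in>T. if n = k then l n * mono_fun (a, b) P else 0)"
          unfolding sum_distrib_right sum_subtractf[symmetric] F_def
          by (intro sum.cong) (auto simp: algebra_simps)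
        also have "\<dots> = - l k * mono_fun (a, b) P"
          using zero[OF P] finT k by simp
        finally show "- inverse (l k) * (\<Sum>n\<in>T. l n * F n P) = mono_fun (a, b) P"
          using k by simp
      qed
      then show False using mono_fun_not_lower[OF std] by blast
    qed
  qed (auto simp: T_def)
  moreover have "w + 1 \<le> card T + 2 * card (gaps q)"
  proof -
    have fin: "finite T" "finite (gaps q)" using gaps_card[OF q] by (auto simp: T_def)
    have "{..w} \<subseteq> T \<union> gaps q \<union> (\<lambda>n. w - n) ` gaps q"
    proof
      fix n assume n: "n \<in> {..w}"
      then have "n = w - (w - n)" by simp
      then show "n \<in> T \<union> gaps q \<union> (\<lambda>n. w - n) ` gaps q"
        using n unfolding T_def by blast
    qed
    then have "card {..w} \<le> card (T \<union> gaps q \<union> (\<lambda>n. w - n) ` gaps q)"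
      using fin by (intro card_mono) auto
    also have "\<dots> \<le> card T + card (gaps q) + card ((\<lambda>n. w - n) ` gaps q)"
      by (rule order.trans[OF card_Un_le add_right_mono[OF card_Un_le]])
    also have "card ((\<lambda>n. w - n) ` gaps q) \<le> card (gaps q)"
      by (rule card_image_le[OF fin(2)])
    finally show ?thesis by simp
  qed
  ultimately show ?thesis using gaps_card(2)[OF q] unfolding w_def by linarith
qed

section \<open>Power sums over the points of the curve\<close>

text \<open>
  Let \<open>R z\<close> be the product of the factors of \<open>p\<close> belonging to the roots other than \<open>z\<close>; its value
  at \<open>z\<close> is \<open>p' z = d\<close>. Lagrange interpolation shows that the sum of the \<open>z ^ s * R z\<close> is the
  polynomial \<open>d X^s\<close>, and the power sum is its coefficient at degree \<open>card Z - 1\<close>.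
\<close>

lemma power_sum_roots:
  fixes p :: "'a::field poly"
  assumes fin: "finite Z" and monic: "lead_coeff p = 1" and deg: "degree p = card Z"
    and roots: "\<And>z. z \<in> Z \<Longrightarrow> poly p z = 0" and deriv: "pderiv p = [:d:]"
    and s: "s < card Z"
  shows "(\<Sum>z\<in>Z. z ^ s) = (if s = card Z - 1 then d else 0)"
proof -
  define n where "n = card Z"
  define R where "R A = (\<Prod>w\<in>A. [:-w, 1:])" for A :: "'a set"
  have degR: "degree (R A) = card A" and leadR: "coeff (R A) (card A) = 1" for A :: "'a set"
  proof -
    show "degree (R A) = card A"
      unfolding R_def by (subst degree_prod_eq_sum_degree) auto
    then show "coeff (R A) (card A) = 1"
      using lead_coeff_prod[of "\<lambda>w. [:-w, 1:]" A] by (simp add: R_def)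
  qed
  have p_eq: "p = R Z"
  proof (rule ccontr)
    assume "p \<noteq> R Z"
    then have nz: "p - R Z \<noteq> 0" by simp
    have "degree (p - R Z) \<le> n"
      by (intro degree_diff_le) (simp_all add: deg degR n_def)
    moreover have "coeff (p - R Z) n = 0"
      using monic deg leadR[of Z] by (simp add: n_def)
    ultimately have "degree (p - R Z) < n"
      using nz by (metis le_neq_implies_less leading_coeff_0_iff)
    moreover have "Z \<subseteq> {z. poly (p - R Z) z = 0}"
      using roots fin by (auto simp: R_def poly_prod)
    then have "n \<le> card {z. poly (p - R Z) z = 0}"
      unfolding n_def using poly_roots_finite[OF nz] by (rule card_mono[rotated])
    ultimately show False
      using card_poly_roots_bound[OF nz] by linarith
  qed
  have Rz: "poly (R (Z - {z})) z = d" if z: "z \<in> Z" for z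
  proof -
    have "d = poly (pderiv (R Z)) z" using deriv p_eq by simp
    also have "\<dots> = (\<Sum>a\<in>Z. poly (R (Z - {a})) z)"
      unfolding R_def by (simp add: pderiv_prod poly_sum pderiv_pCons)
    also have "\<dots> = (\<Sum>a\<in>{z}. poly (R (Z - {a})) z)"
      by (intro sum.mono_neutral_right) (use z fin in \<open>auto simp: R_def poly_prod\<close>)
    finally show ?thesis by simp
  qed
  define L where "L = (\<Sum>z\<in>Z. Polynomial.smult (z ^ s) (R (Z - {z})))"
  have "L = monom d s"
  proof (rule ccontr)
    assume "L \<noteq> monom d s"
    then have nz: "L - monom d s \<noteq> 0" by simp
    have "degree L \<le> n - 1"
      unfolding L_def using fin
      by (intro degree_sum_le) (auto intro!: order.trans[OF degree_smult_le] simp: degR n_def)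
    moreover have "degree (monom d s) \<le> n - 1"
      using s degree_monom_le[of d s] by (simp add: n_def)
    ultimately have "degree (L - monom d s) \<le> n - 1"
      by (rule degree_diff_le)
    moreover have "Z \<subseteq> {z. poly (L - monom d s) z = 0}"
    proof
      fix z assume z: "z \<in> Z"
      have "poly L z = (\<Sum>a\<in>Z. a ^ s * poly (R (Z - {a})) z)"
        unfolding L_def by (simp add: poly_sum)
      also have "\<dots> = (\<Sum>a\<in>{z}. a ^ s * poly (R (Z - {a})) z)"
        by (intro sum.mono_neutral_right) (use z fin in \<open>auto simp: R_def poly_prod\<close>)
      finally show "z \<in> {z. poly (L - monom d s) z = 0}"
        using Rz[OF z] by (simp add: poly_monom)
    qed
    then have "n \<le> card {z. poly (L - monom d s) z = 0}"
      unfolding n_def using poly_roots_finite[OF nz] by (rule card_mono[rotated])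
    ultimately show False
      using card_poly_roots_bound[OF nz] s by (simp add: n_def)
  qed
  then have "coeff L (n - 1) = (if s = n - 1 then d else 0)" by simp
  moreover have "coeff (R (Z - {z})) (n - 1) = 1" if "z \<in> Z" for z
    using leadR[of "Z - {z}"] that fin by (simp add: n_def)
  then have "coeff L (n - 1) = (\<Sum>z\<in>Z. z ^ s)"
    unfolding L_def by (simp add: coeff_sum)
  ultimately show ?thesis by (simp add: n_def)
qed

lemma bounded_sum_attains_bound:
  fixes f :: "'a \<Rightarrow> nat"
  assumes "finite A" "\<And>x. x \<in> A \<Longrightarrow> f x \<le> k" "sum f A = card A * k" "x \<in> A"
  shows "f x = k"
proof (rule ccontr)
  assume "f x \<noteq> k"
  then have "f x < k" using assms(2,4) by (simp add: order_less_le)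
  then have "sum f A < sum (\<lambda>_. k) A"
    using assms by (intro sum_strict_mono_ex1) auto
  then show False using assms(3) by simp
qed

text \<open>
  Knowing the number of rational points, one gets the sizes of the fibres of norm and trace from
  degree bounds for univariate polynomials: no vertical line meets the curve in more than \<open>q\<close>
  points, so the total \<open>q^3\<close> forces each of the \<open>q^2\<close> vertical lines to meet it in exactly \<open>q\<close>.
\<close>

locale hermitian_curve =
  fixes q :: nat and F :: "'a::{field, finite} itself"
  assumes q2: "2 \<le> q" and card_field: "CARD('a) = q^2"
    and card_curve: "card (hermitian_points q :: ('a \<times> 'a) set) = q^3"
begin

abbreviation curve :: "('a \<times> 'a) set" where "curve \<equiv> hermitian_points q"

lemma of_nat_q: "of_nat q = (0 :: 'a)"
proof -
  have "(\<Sum>x\<in>UNIV. x + 1) = (\<Sum>x\<in>UNIV. x :: 'a)"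
    by (rule sum.reindex_bij_witness[where i = "\<lambda>x. x - 1" and j = "\<lambda>x. x + 1"]) auto
  then have "of_nat (q^2) = (0 :: 'a)"
    by (simp add: sum.distrib card_field)
  then show ?thesis by simp
qed

definition trace_poly :: "'a \<Rightarrow> 'a poly" where
  "trace_poly c = monom 1 q + [:-c, 1:]"

lemma poly_trace_poly: "poly (trace_poly c) y = y ^ q + y - c"
  by (simp add: trace_poly_def poly_monom)

lemma degree_trace_poly: "degree (trace_poly c) = q"
  unfolding trace_poly_def
  by (subst degree_add_eq_left) (use q2 in \<open>auto simp: degree_monom_eq\<close>)

lemma trace_poly_nonzero: "trace_poly c \<noteq> 0"
  using degree_trace_poly[of c] q2 by auto

lemma lead_coeff_trace_poly: "lead_coeff (trace_poly c) = 1"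
  using q2 by (simp only: degree_trace_poly) (simp add: trace_poly_def coeff_pCons split: nat.split)

lemma pderiv_trace_poly: "pderiv (trace_poly c) = [:1:]"
  by (simp add: trace_poly_def pderiv_add pderiv_monom pderiv_pCons of_nat_q)

lemma roots_trace_poly: "{y. y ^ q + y = c} = {y. poly (trace_poly c) y = 0}"
  by (simp add: poly_trace_poly)

lemma curve_Sigma: "curve = (SIGMA x:UNIV. {y. y ^ q + y = x ^ (q + 1)})"
  by (auto simp: mem_hermitian_points)

lemma card_vertical_fibre: "card {y :: 'a. y ^ q + y = x ^ (q + 1)} = q"
proof (rule bounded_sum_attains_bound[where A = UNIV
      and f = "\<lambda>x. card {y :: 'a. y ^ q + y = x ^ (q + 1)}"])
  show "card {y :: 'a. y ^ q + y = z ^ (q + 1)} \<le> q" if "z \<in> UNIV" for z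
    using card_poly_roots_bound[OF trace_poly_nonzero[of "z ^ (q + 1)"]]
    by (simp only: roots_trace_poly degree_trace_poly)
  have "q ^ 3 = (\<Sum>x\<in>UNIV. card {y :: 'a. y ^ q + y = x ^ (q + 1)})"
    using card_curve curve_Sigma by simp
  then show "(\<Sum>x\<in>UNIV. card {y :: 'a. y ^ q + y = x ^ (q + 1)}) = CARD('a) * q"
    by (simp add: card_field power2_eq_square power3_eq_cube)
qed auto

text \<open>
  The \<open>q\<close> ordinates of trace \<open>0\<close> carry one point each, the remaining \<open>q^2 - q\<close> ordinates at
  most \<open>q + 1\<close> points each. The total \<open>q^3 = q + (q^2 - q)(q + 1)\<close> leaves no slack.
\<close>

lemma card_horizontal_fibre:
  assumes y: "y ^ q + y \<noteq> (0 :: 'a)"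
  shows "card {x :: 'a. x ^ (q + 1) = y ^ q + y} = q + 1"
proof -
  let ?fib = "\<lambda>y. {x :: 'a. x ^ (q + 1) = y ^ q + y}"
  let ?K = "{y :: 'a. y ^ q + y = 0}"
  have K: "card ?K = q" using card_vertical_fibre[of 0] by simp
  have fib_K: "?fib y = {0}" if "y \<in> ?K" for y using that by auto
  have "curve = prod.swap ` (SIGMA y:UNIV. ?fib y)"
    by (force simp: mem_hermitian_points)
  then have "q ^ 3 = card (SIGMA y:UNIV. ?fib y)"
    using card_curve by (simp add: card_image)
  also have "\<dots> = (\<Sum>y\<in>UNIV. card (?fib y))" by simp
  also have "\<dots> = (\<Sum>y\<in>?K. card (?fib y)) + (\<Sum>y\<in>-?K. card (?fib y))"
    using sum.union_disjoint[of ?K "-?K" "\<lambda>y. card (?fib y)"]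
    by (simp only: Compl_partition) auto
  also have "(\<Sum>y\<in>?K. card (?fib y)) = q" using fib_K K by simp
  finally have total: "q ^ 3 = q + (\<Sum>y\<in>-?K. card (?fib y))" .
  have cK: "card (-?K) = q^2 - q" using K card_field by (simp add: Compl_eq_Diff_UNIV card_Diff_subset)
  have "q ^ 3 - q = (q^2 - q) * (q + 1)"
    by (simp add: algebra_simps power2_eq_square power3_eq_cube)
  then have total': "(\<Sum>y\<in>-?K. card (?fib y)) = card (-?K) * (q + 1)"
    using total cK by simp
  have "card (?fib y) \<le> q + 1" for y :: 'a
  proof -
    let ?p = "monom 1 (q + 1) + [:- (y ^ q + y):]"
    have "degree ?p = q + 1"
      by (subst degree_add_eq_left) (auto simp: degree_monom_eq)
    moreover from this have "?p \<noteq> 0" by auto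
    ultimately show ?thesis
      using card_poly_roots_bound[of ?p] by (simp add: poly_monom algebra_simps)
  qed
  then show ?thesis
    using bounded_sum_attains_bound[OF _ _ total', of y] y by auto
qed

lemma power_field_size: "x ^ (q^2) = (x :: 'a)"
proof (cases "x = 0")
  case False
  let ?U = "UNIV - {0 :: 'a}"
  have "(\<Prod>u\<in>?U. x * u) = (\<Prod>u\<in>?U. u)"
    by (rule prod.reindex_bij_witness[where i = "\<lambda>u. u / x" and j = "\<lambda>u. x * u"])
       (use False in auto)
  then have "x ^ card ?U * (\<Prod>u\<in>?U. u) = (\<Prod>u\<in>?U. u)"
    by (simp add: prod.distrib)
  moreover have "(\<Prod>u\<in>?U. u) \<noteq> 0" by simp
  ultimately have "x ^ (q^2 - 1) = 1"
    by (simp add: card_field card_Diff_subset)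
  moreover have "q^2 = Suc (q^2 - 1)" using q2 by simp
  ultimately show ?thesis by (metis power_Suc mult_1_right)
qed (use q2 in simp)

lemma sum_power_field:
  assumes "r < q^2"
  shows "(\<Sum>x\<in>UNIV. x ^ r) = (if r = q^2 - 1 then -1 else (0 :: 'a))"
proof -
  let ?p = "monom 1 (q^2) + [:0, -1:] :: 'a poly"
  have qq: "1 < q^2" using q2 power_strict_increasing[of 0 2 q] by simp
  have deg: "degree ?p = q^2"
    by (subst degree_add_eq_left) (use qq in \<open>auto simp: degree_monom_eq\<close>)
  have "(\<Sum>x\<in>UNIV. x ^ r) = (if r = CARD('a) - 1 then -1 else (0 :: 'a))"
  proof (rule power_sum_roots[of UNIV ?p])
    show "lead_coeff ?p = 1"
      using qq q2 by (simp only: deg) (simp add: coeff_pCons split: nat.split)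
    show "poly ?p z = 0" for z
      by (simp add: poly_monom power_field_size)
    show "pderiv ?p = [:-1:]"
      by (simp add: pderiv_add pderiv_monom pderiv_pCons of_nat_q pderiv_diff pderiv_minus)
  qed (use deg assms card_field in auto)
  then show ?thesis by (simp add: card_field)
qed

lemma sum_power_vertical_fibre:
  assumes "s < q"
  shows "(\<Sum>y\<in>{y. y ^ q + y = x ^ (q + 1)}. y ^ s) = (if s = q - 1 then 1 else (0 :: 'a))"
  using power_sum_roots[of "{y. y ^ q + y = x ^ (q + 1)}" "trace_poly (x ^ (q + 1))" 1 s]
    assms card_vertical_fibre[of x]
  by (simp add: degree_trace_poly lead_coeff_trace_poly[unfolded degree_trace_poly]
      pderiv_trace_poly poly_trace_poly)

text \<open>
  A function \<open>g\<close> on the curve is identified with the functional that sums \<open>g * f\<close> over the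
  curve; its moments are the values of the functional on monomials.
\<close>

definition moment :: "('a \<times> 'a \<Rightarrow> 'a) \<Rightarrow> nat \<Rightarrow> nat \<Rightarrow> 'a" where
  "moment g r s = (\<Sum>(x, y)\<in>curve. g (x, y) * (x ^ r * y ^ s))"

text \<open>
  One value \<open>d\<close> serves all monomials of \<open>w\<close>-degree \<open>k\<close>, because on the curve any two of them
  differ by monomials of lower \<open>w\<close>-degree.
\<close>

definition leading_moment :: "('a \<times> 'a \<Rightarrow> 'a) \<Rightarrow> nat \<Rightarrow> 'a \<Rightarrow> bool" where
  "leading_moment g k d \<longleftrightarrow> (\<forall>r s.
     (wdeg q (r, s) < k \<longrightarrow> moment g r s = 0) \<and> (wdeg q (r, s) = k \<longrightarrow> moment g r s = d))"

text \<open>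
  The curve equation rewrites \<open>y^q\<close> as \<open>x^(q + 1) - y\<close>, where the first term preserves the
  \<open>w\<close>-degree and the second lowers it; this reduces to \<open>s < q\<close>. There the sum over a
  vertical fibre vanishes unless \<open>s = q - 1\<close>, in which case it is \<open>1\<close> and a power sum over
  the whole field remains. The bound is \<open>wdeg q (r, s)\<close> against \<open>(q^2 - 1)(q + 1)\<close>, with
  \<open>q + 1\<close> added on both sides to avoid subtraction.
\<close>

lemma power_sum_curve:
  "(r * q + (s + 1) * (q + 1) < q^2 * (q + 1) \<longrightarrow> (\<Sum>(x, y)\<in>curve. x ^ r * y ^ s) = 0) \<and>
   (r * q + (s + 1) * (q + 1) = q^2 * (q + 1) \<longrightarrow> (\<Sum>(x, y)\<in>curve. x ^ r * y ^ s) = -1)"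
proof (induction s arbitrary: r rule: less_induct)
  case (less s)
  let ?S = "\<lambda>r s. \<Sum>(x, y)\<in>curve. x ^ r * y ^ s"
  show ?case
  proof (cases "s < q")
    case True
    have "?S r s = (\<Sum>x\<in>UNIV. \<Sum>y\<in>{y. y ^ q + y = x ^ (q + 1)}. x ^ r * y ^ s)"
      unfolding curve_Sigma by (subst sum.Sigma) auto
    also have "\<dots> = (\<Sum>x\<in>UNIV. x ^ r) * (if s = q - 1 then 1 else 0)"
      unfolding sum_distrib_left[symmetric] sum_power_vertical_fibre[OF True]
      by (simp add: sum_distrib_right)
    finally have S: "?S r s = (\<Sum>x\<in>UNIV. x ^ r) * (if s = q - 1 then 1 else 0)" .
    show ?thesis
    proof (cases "s = q - 1")
      case True
      then have s1: "s + 1 = q" using q2 by simp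
      have less: "r * q + (s + 1) * (q + 1) < q^2 * (q + 1) \<longleftrightarrow> r + (q + 1) < q * (q + 1)"
        unfolding s1 using q2 mult_less_cancel1[of q "r + (q + 1)" "q * (q + 1)"]
        by (simp add: power2_eq_square algebra_simps)
      have eq: "r * q + (s + 1) * (q + 1) = q^2 * (q + 1) \<longleftrightarrow> r + (q + 1) = q * (q + 1)"
        unfolding s1 using q2 mult_cancel1[of q "r + (q + 1)" "q * (q + 1)"]
        by (simp add: power2_eq_square algebra_simps)
      have qq: "q * (q + 1) = q^2 + q" by (simp add: power2_eq_square)
      show ?thesis
        unfolding less eq qq using S True sum_power_field[of r] by auto
    next
      case s: False
      have "r * q + (s + 1) * (q + 1) \<noteq> q^2 * (q + 1)"
      proof
        assume "r * q + (s + 1) * (q + 1) = q^2 * (q + 1)"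
        then have "s + 1 + q * (r + s + 1) = q * (q * (q + 1))"
          by (simp add: power2_eq_square algebra_simps)
        then have "q dvd s + 1"
          by (metis dvd_add_left_iff dvd_triv_left)
        then show False using True s dvd_imp_le[of q "s + 1"] by auto
      qed
      then show ?thesis using S s by simp
    qed
  next
    case False
    define s' where "s' = s - q"
    have s: "s = s' + q" using False by (simp add: s'_def)
    have w1: "(r + (q + 1)) * q + (s' + 1) * (q + 1) = r * q + (s + 1) * (q + 1)"
      by (simp add: s algebra_simps)
    have w2: "r * q + (s' + 1 + 1) * (q + 1) < r * q + (s + 1) * (q + 1)"
      unfolding add_less_cancel_left by (rule mult_strict_right_mono) (use q2 s in auto)
    have lt: "s' < s" "s' + 1 < s" using q2 by (auto simp: s)
    have "x ^ r * y ^ s = x ^ (r + (q + 1)) * y ^ s' - x ^ r * y ^ (s' + 1)"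
      if "(x, y) \<in> curve" for x y
    proof -
      have "x ^ (r + (q + 1)) * y ^ s' = x ^ r * y ^ s' * (y ^ q + y)"
        unfolding power_add[of x r] using that[unfolded mem_hermitian_points] by simp
      then show ?thesis by (simp add: s power_add algebra_simps)
    qed
    then have S: "?S r s = ?S (r + (q + 1)) s' - ?S r (s' + 1)"
      unfolding sum_subtractf[symmetric] by (intro sum.cong) auto
    show ?thesis
      using less.IH[OF lt(1), of "r + (q + 1)"] less.IH[OF lt(2), of r] w2
      unfolding S w1 by auto
  qed
qed

lemma leading_moment_one: "leading_moment (\<lambda>_. 1) ((q^2 - 1) * (q + 1)) (-1)"
proof -
  have "(q^2 - 1) * (q + 1) + (q + 1) = q^2 * (q + 1)"
    using q2 mult_Suc[of "q^2 - 1" "q + 1"] by simp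
  then show ?thesis
    using power_sum_curve unfolding leading_moment_def moment_def by (simp add: wdeg_def)
qed

text \<open>
  Multiplication by \<open>x - \<alpha>\<close> turns the moment of \<open>x^r y^s\<close> into the one of \<open>x^(r + 1) y^s\<close> minus a
  moment of lower \<open>w\<close>-degree, so the critical degree drops by the \<open>w\<close>-degree of \<open>x\<close>.
\<close>

lemma leading_moment_mult_x:
  assumes "leading_moment g (k + q) d"
  shows "leading_moment (\<lambda>(x, y). (x - \<alpha>) * g (x, y)) k d"
proof -
  have "moment (\<lambda>(x, y). (x - \<alpha>) * g (x, y)) r s = moment g (r + 1) s - \<alpha> * moment g r s" for r s
    unfolding moment_def sum_distrib_left sum_subtractf[symmetric]
    by (intro sum.cong) (auto simp: algebra_simps)
  then show ?thesis
    using assms q2 unfolding leading_moment_def by (simp add: wdeg_def)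
qed

lemma leading_moment_mult_y:
  assumes "leading_moment g (k + (q + 1)) d"
  shows "leading_moment (\<lambda>(x, y). (y - \<gamma>) * g (x, y)) k d"
proof -
  have "moment (\<lambda>(x, y). (y - \<gamma>) * g (x, y)) r s = moment g r (s + 1) - \<gamma> * moment g r s" for r s
    unfolding moment_def sum_distrib_left sum_subtractf[symmetric]
    by (intro sum.cong) (auto simp: algebra_simps)
  then show ?thesis
    using assms q2 unfolding leading_moment_def by (simp add: wdeg_def)
qed

definition line_product :: "'a set \<Rightarrow> 'a set \<Rightarrow> 'a \<times> 'a \<Rightarrow> 'a" where
  "line_product A G = (\<lambda>(x, y). (\<Prod>\<alpha>\<in>A. x - \<alpha>) * (\<Prod>\<gamma>\<in>G. y - \<gamma>))"

lemma leading_moment_line_product: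
  assumes "k + card A * q + card G * (q + 1) = (q^2 - 1) * (q + 1)"
  shows "leading_moment (line_product A G) k (-1)"
proof -
  have fin: "finite X" for X :: "'a set" by simp
  have base: "leading_moment (line_product {} G) k (-1)"
    if "k + card G * (q + 1) = (q^2 - 1) * (q + 1)" for k
    using fin[of G] that
  proof (induction G arbitrary: k)
    case empty
    then show ?case using leading_moment_one by (simp add: line_product_def)
  next
    case (insert \<gamma> G)
    have "(\<lambda>(x, y). (y - \<gamma>) * line_product {} G (x, y)) = line_product {} (insert \<gamma> G)"
      using insert.hyps by (auto simp: line_product_def)
    then show ?case
      using leading_moment_mult_y[OF insert.IH[of "k + (q + 1)"], of \<gamma>] insert.prems insert.hyps
      by (simp add: algebra_simps)
  qed
  show ?thesis
    using fin[of A] assms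
  proof (induction A arbitrary: k)
    case empty
    then show ?case using base by simp
  next
    case (insert \<alpha> A)
    have "(\<lambda>(x, y). (x - \<alpha>) * line_product A G (x, y)) = line_product (insert \<alpha> A) G"
      using insert.hyps by (auto simp: line_product_def algebra_simps)
    then show ?case
      using leading_moment_mult_x[OF insert.IH[of "k + q"], of \<alpha>] insert.prems insert.hyps
      by (simp add: algebra_simps)
  qed
qed

section \<open>A functional of minimal support\<close>

lemma card_zeros_line_product:
  assumes nz: "\<And>\<gamma>. \<gamma> \<in> G \<Longrightarrow> \<gamma> ^ q + \<gamma> \<noteq> 0"
    and disj: "\<And>\<alpha> \<gamma>. \<alpha> \<in> A \<Longrightarrow> \<gamma> \<in> G \<Longrightarrow> \<alpha> ^ (q + 1) \<noteq> \<gamma> ^ q + \<gamma>"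
  shows "card {P \<in> curve. line_product A G P = 0} = card A * q + card G * (q + 1)"
proof -
  let ?X = "SIGMA \<alpha>:A. {y. y ^ q + y = \<alpha> ^ (q + 1)}"
  let ?Y = "SIGMA \<gamma>:G. {x. x ^ (q + 1) = \<gamma> ^ q + \<gamma>}"
  have "{P \<in> curve. line_product A G P = 0} = ?X \<union> prod.swap ` ?Y"
    by (force simp: line_product_def mem_hermitian_points)
  moreover have "?X \<inter> prod.swap ` ?Y = {}" using disj by auto
  moreover have "card ?X = card A * q"
    by (subst card_SigmaI) (simp_all only: finite card_vertical_fibre sum_constant of_nat_id ball_UNIV, simp)
  moreover have "card (prod.swap ` ?Y) = card G * (q + 1)"
  proof -
    have "card ?Y = (\<Sum>\<gamma>\<in>G. card {x. x ^ (q + 1) = \<gamma> ^ q + \<gamma>})"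
      by (rule card_SigmaI) auto
    also have "\<dots> = (\<Sum>\<gamma>\<in>G. q + 1)"
      by (intro sum.cong card_horizontal_fibre nz refl)
    also have "\<dots> = card G * (q + 1)" by simp
    finally have "card ?Y = card G * (q + 1)" .
    moreover have "card (prod.swap ` ?Y) = card ?Y" by (rule card_image) simp
    ultimately show ?thesis by simp
  qed
  ultimately show ?thesis by (simp add: card_Un_disjoint)
qed

text \<open>
  The ordinates are taken of trace \<open>1\<close> and the abscissas of norm different from \<open>1\<close>, so that no
  vertical line meets a horizontal one on the curve. This leaves \<open>q^2 - q - 1\<close> abscissas, unless
  there are no horizontal lines at all.
\<close>

lemma exists_line_product:
  assumes "v = 0 \<and> u \<le> q^2 \<or> v \<le> q \<and> u + q + 1 \<le> q^2"
  obtains A G where "card A = u" "card G = v"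
    "card {P \<in> curve. line_product A G P = 0} = u * q + v * (q + 1)"
proof -
  have norm1: "card {x :: 'a. x ^ (q + 1) = 1} = q + 1"
    and trace1: "card {y :: 'a. y ^ q + y = 1} = q"
  proof -
    show *: "card {y :: 'a. y ^ q + y = 1} = q" using card_vertical_fibre[of 1] by simp
    then have "{y :: 'a. y ^ q + y = 1} \<noteq> {}" using q2 by (metis card.empty not_numeral_le_zero)
    then obtain y :: 'a where "y ^ q + y = 1" by auto
    then show "card {x :: 'a. x ^ (q + 1) = 1} = q + 1"
      using card_horizontal_fibre[of y] by simp
  qed
  from assms consider "v = 0" "u \<le> q^2" | "v \<le> q" "u + q + 1 \<le> q^2" by blast
  then show ?thesis
  proof cases
    case 1
    then obtain A :: "'a set" where "card A = u"
      using obtain_subset_with_card_n[of u "UNIV :: 'a set"] card_field by auto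
    then show ?thesis using that[of A "{}"] card_zeros_line_product[of "{}" A] 1 by simp
  next
    case 2
    have "card (UNIV - {x :: 'a. x ^ (q + 1) = 1}) = q^2 - (q + 1)"
      by (subst card_Diff_subset) (auto simp: card_field norm1[simplified])
    then obtain A where A: "A \<subseteq> UNIV - {x :: 'a. x ^ (q + 1) = 1}" "card A = u"
      using obtain_subset_with_card_n[of u "UNIV - {x :: 'a. x ^ (q + 1) = 1}"] 2
      by (metis Nat.le_diff_conv2 add.assoc le_add2 order.trans)
    obtain G where G: "G \<subseteq> {y :: 'a. y ^ q + y = 1}" "card G = v"
      using obtain_subset_with_card_n[of v "{y :: 'a. y ^ q + y = 1}"] trace1 2 by auto
    have "card {P \<in> curve. line_product A G P = 0} = card A * q + card G * (q + 1)"
    proof (rule card_zeros_line_product)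
      show "\<gamma> ^ q + \<gamma> \<noteq> 0" if "\<gamma> \<in> G" for \<gamma> using that G by auto
      show "\<alpha> ^ (q + 1) \<noteq> \<gamma> ^ q + \<gamma>" if "\<alpha> \<in> A" "\<gamma> \<in> G" for \<alpha> \<gamma>
      proof -
        have "\<gamma> ^ q + \<gamma> = 1" "\<alpha> ^ (q + 1) \<noteq> 1" using that A(1) G(1) by blast+
        then show ?thesis by simp
      qed
    qed
    then show ?thesis using that[of A G] A G by simp
  qed
qed

text \<open>
  The line product must have \<open>w\<close>-degree equal to the difference \<open>t\<close> of
  \<open>(q^2 - 1)(q + 1)\<close> and \<open>wdeg q (a, b)\<close>, and then has \<open>t\<close> distinct zeros among the
  \<open>q^3\<close> points. Here \<open>t = (q^2 - 1 - b)(q + 1) - a q\<close>. Trading \<open>q\<close> horizontal lines for \<open>q + 1\<close>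
  vertical ones preserves the degree, so fewer than \<open>q\<close> horizontal lines suffice. The shape of
  \<open>B_monos q\<close> makes the number \<open>u\<close> of vertical lines nonnegative, and the lower
  bound on the \<open>w\<close>-degree keeps \<open>u\<close> small enough to avoid the abscissas of norm \<open>1\<close>
  whenever horizontal lines occur.
\<close>

lemma exists_minimal_functional:
  assumes B: "(a, b) \<in> B_monos q"
    and low: "2 * q^2 \<le> wdeg q (a, b) + 2 * q + 1"
  obtains g where "leading_moment g (wdeg q (a, b)) (-1)"
    "card {P \<in> curve. g P \<noteq> 0} + q^2 = wdeg q (a, b) + q + 1"
proof -
  have qq: "q + 1 \<le> q^2"
    using q2 mult_le_mono1[of 2 q q] unfolding power2_eq_square by linarith
  have b: "b < q^2" and a: "a \<le> q" and ab: "q^2 \<le> b + q \<Longrightarrow> a = 0"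
    using B qq by (auto simp: B_monos_def)
  define l where "l = q^2 - 1 - b"
  define j where "j = l div q"
  define v where "v = l mod q"
  have l: "l + 1 + b = q^2" using b by (simp add: l_def)
  have jv: "l = j * q + v" by (simp add: j_def v_def)
  have v: "v < q" using q2 by (simp add: v_def)
  have a_le: "a \<le> j * (q + 1)"
  proof (cases "j = 0")
    case True
    then have "q^2 \<le> b + q" using l jv v by simp
    then show ?thesis using ab by simp
  next
    case False
    then show ?thesis using a by (cases j) auto
  qed
  define u where "u = j * (q + 1) - a"
  have u: "u + a = j * (q + 1)" using a_le by (simp add: u_def)
  have total: "wdeg q (a, b) + u * q + v * (q + 1) = (q^2 - 1) * (q + 1)"
  proof -
    have "wdeg q (a, b) + u * q + v * (q + 1) = (u + a) * q + (b + v) * (q + 1)"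
      by (simp add: wdeg_def algebra_simps)
    also have "\<dots> = (l + b) * (q + 1)" unfolding u jv by (simp add: algebra_simps)
    also have "l + b = q^2 - 1" using l by simp
    finally show ?thesis .
  qed
  have top: "(q^2 - 1) * (q + 1) + q + 1 = q ^ 3 + q^2"
    using q2 mult_Suc[of "q^2 - 1" "q + 1"]
    by (simp add: power2_eq_square power3_eq_cube)
  have "v = 0 \<and> u \<le> q^2 \<or> v \<le> q \<and> u + q + 1 \<le> q^2"
  proof (cases "v = 0")
    case True
    have "j * q < q * q" using jv l unfolding power2_eq_square by linarith
    then have "j < q" by (metis mult_less_cancel2)
    then have "j + 1 \<le> q" by simp
    then have "(j + 1) * (q + 1) \<le> q * (q + 1)" by (rule mult_le_mono1)
    then have "u \<le> q^2" using u by (simp add: power2_eq_square algebra_simps)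
    then show ?thesis using True by simp
  next
    case False
    have "u * q + v * (q + 1) + q^2 \<le> q ^ 3 + q"
      using total top low by linarith
    moreover have "q + 1 \<le> v * (q + 1)" using False mult_le_mono1[of 1 v "q + 1"] by simp
    ultimately have "u * q + q^2 < q ^ 3" by linarith
    then have "(u + q) * q < q^2 * q" by (simp add: algebra_simps power2_eq_square power3_eq_cube)
    then have "u + q < q^2" by simp
    then show ?thesis using v by simp
  qed
  then obtain A G where AG: "card A = u" "card G = v"
    "card {P \<in> curve. line_product A G P = 0} = u * q + v * (q + 1)"
    by (rule exists_line_product)
  have "leading_moment (line_product A G) (wdeg q (a, b)) (-1)"
    using AG total by (intro leading_moment_line_product) simp
  moreover have "card {P \<in> curve. line_product A G P \<noteq> 0} + (u * q + v * (q + 1)) = q ^ 3"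
  proof -
    have "card {P \<in> curve. line_product A G P \<noteq> 0} + card {P \<in> curve. line_product A G P = 0}
        = card ({P \<in> curve. line_product A G P \<noteq> 0} \<union> {P \<in> curve. line_product A G P = 0})"
      by (intro card_Un_disjoint[symmetric]) auto
    also have "{P \<in> curve. line_product A G P \<noteq> 0} \<union> {P \<in> curve. line_product A G P = 0} = curve"
      by auto
    finally show ?thesis using AG card_curve by simp
  qed
  ultimately show ?thesis
    using total top by (intro that[of "line_product A G"]) linarith+
qed

end

section \<open>The theorem\<close>

lemma dual_code_vec_span:
  fixes S :: "'a::field vec set"
  assumes S: "S \<subseteq> carrier_vec n"
  shows "dual_code n (vec_span n S) = dual_code n S"
proof -
  interpret vec_space "TYPE('a)" n .
  have in_span: "S \<subseteq> span S" using S by (rule in_own_span)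
  have "c \<bullet> v = 0" if c: "c \<in> dual_code n S" and v: "v \<in> span S" for c v
  proof -
    let ?N = "{v \<in> carrier_vec n. c \<bullet> v = 0}"
    have c': "c \<in> carrier_vec n" using c by (simp add: dual_code_def)
    have "submodule class_ring ?N V"
      by (rule LinearCombinations.submodule.intro) (use c' module_axioms in \<open>auto simp: scalar_prod_add_distrib[of _ n] class_field_def module_vec_def\<close>)
    moreover have "S \<subseteq> ?N" using c S by (auto simp: dual_code_def)
    ultimately have "span S \<subseteq> ?N" by (simp only: span_is_subset)
    then show ?thesis using v by blast
  qed
  then show ?thesis
    using in_span unfolding vec_span_def dual_code_def by auto
qed

theorem theorem4p2:
  fixes q a b :: nat and m :: int
    and P :: "nat \<Rightarrow> 'a::{field, finite} \<times> 'a"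
  assumes q: "primepow q"
    and card_field: "CARD('a) = q^2"
    and points: "bij_betw P {..<q^3} (hermitian_points q)"
    and m_le: "m \<le> int q^3 + int q^2 - int q - 2"
    and label: "\<exists>e \<in> B_monos q. int (wdeg q e) = m + 1"
    and m_ge: "m \<ge> 2 * int q^2 - 2 * int q - 2"
    and ab: "(a, b) \<in> B_monos q - B_upto q m"
    and w_ge: "m + 1 \<le> int (wdeg q (a, b))"
    and w_le: "int (wdeg q (a, b)) \<le> m + int q + 1"
  shows
    "(\<forall>D :: ('a \<times> 'a) set.
        hermitian_divisor q D \<and>
        (a, b) \<in> standard_monos (initial_ideal (vanishing_ideal D)) \<and>
        (\<exists>c \<in> hermitian_code q P m. D = codeword_support P c) \<longrightarrow>
        int (card D) \<ge> int (wdeg q (a, b)) - (int q^2 - int q) + 1) \<and>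
     (\<exists>D' :: ('a \<times> 'a) set.
        hermitian_divisor q D' \<and>
        (\<exists>c \<in> hermitian_code q P m. D' = codeword_support P c) \<and>
        (a, b) \<in> standard_monos (initial_ideal (vanishing_ideal D')) \<and>
        int (card D') = int (wdeg q (a, b)) - (int q^2 - int q) + 1)"
proof -
  have q2: "2 \<le> q" using primepow_gt_Suc_0[OF q] by simp
  have a: "a \<le> q" using ab by (auto simp: B_monos_def)
  interpret hermitian_curve q "TYPE('a)"
    using q2 card_field bij_betw_same_card[OF points] by unfold_locales simp_all
  let ?w = "wdeg q (a, b)"
  have lower: "int (card D) \<ge> int ?w - (int q^2 - int q) + 1"
    if "D \<subseteq> curve" "(a, b) \<in> standard_monos (initial_ideal (vanishing_ideal D))" for D
  proof -
    have "?w + 1 + q \<le> card D + q * q"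
      using card_ge_if_standard[OF that(1) a q2 that(2)] q2 by (cases q) auto
    then have "int (?w + 1 + q) \<le> int (card D + q * q)" by (simp only: of_nat_le_iff)
    then show ?thesis by (simp add: power2_eq_square)
  qed
  have "int (2 * q^2) \<le> int (?w + 2 * q + 1)" using m_ge w_ge by simp
  then have "2 * q^2 \<le> ?w + 2 * q + 1" by (simp only: of_nat_le_iff)
  then obtain g where g: "leading_moment g ?w (-1)"
    and card_g: "card {Q \<in> curve. g Q \<noteq> 0} + q^2 = ?w + q + 1"
    using exists_minimal_functional[of a b] ab by auto
  define D' where "D' = {Q \<in> curve. g Q \<noteq> 0}"
  define c where "c = vec (q^3) (\<lambda>i. g (P i))"
  have curve_P: "curve = P ` {..<q^3}" using points by (simp add: bij_betw_def)
  have supp: "D' = codeword_support P c"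
    unfolding D'_def codeword_support_def c_def curve_P by auto
  have "c \<bullet> eval_vec (q^3) P (mono_poly (r, s)) = moment g r s" for r s
  proof -
    have "c \<bullet> eval_vec (q^3) P (mono_poly (r, s))
        = (\<Sum>i\<in>{..<q^3}. g (P i) * eval2 (mono_poly (r, s)) (P i))"
      by (simp add: scalar_prod_def c_def eval_vec_def lessThan_atLeast0)
    also have "\<dots> = (\<Sum>Q\<in>curve. g Q * eval2 (mono_poly (r, s)) Q)"
      by (rule sum.reindex_bij_betw[OF points])
    finally show ?thesis
      by (simp add: moment_def case_prod_unfold flip: eval2_mono_poly)
  qed
  then have "c \<bullet> eval_vec (q^3) P (mono_poly e) = 0" if "e \<in> B_upto q m" for e
    using that g w_ge by (cases e) (auto simp: B_upto_def leading_moment_def)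
  then have "c \<in> dual_code (q^3) ((\<lambda>e. eval_vec (q^3) P (mono_poly e)) ` B_upto q m)"
    by (auto simp: dual_code_def c_def)
  then have code: "c \<in> hermitian_code q P m"
    unfolding hermitian_code_def by (subst dual_code_vec_span) (auto simp: eval_vec_def)
  have moment_D': "(\<Sum>(x, y)\<in>D'. g (x, y) * (x ^ r * y ^ s)) = moment g r s" for r s
    unfolding moment_def D'_def by (intro sum.mono_neutral_left) auto
  have std: "(a, b) \<in> standard_monos (initial_ideal (vanishing_ideal D'))"
    by (rule standard_mono_if_functional[where g = g])
       (use g wdeg_less_if_drl_less[OF a] in \<open>auto simp: moment_D' leading_moment_def\<close>)
  have "int (card D' + q^2) = int (?w + q + 1)" using card_g by (simp only: D'_def)
  then have "int (card D') = int ?w - (int q^2 - int q) + 1" by simp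
  moreover have "D' \<subseteq> curve" by (auto simp: D'_def)
  ultimately show ?thesis
    using lower supp code std unfolding hermitian_divisor_def by blast
qed

end
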